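(* There exists an infinite family of twin-free graphs $G$ such that $\overset{\rightarrow}{\Gamma}_{LD}(G)/\gamma_{LD}(G)\to 1/2$ as the number of vertices $n$ of $G$ tends to infinity.
   Context: For an undirected graph $G=(V,E)$, $S\subseteq V$ is a locating-dominating set if every $u\notin S$ has $N(u)\cap S\neq\emptyset$ and distinct $u,v\notin S$ satisfy $N(u)\cap S\neq N(v)\cap S$; $\gamma_{LD}(G)$ is the minimum size. For an orientation $D$ of $G$ (each edge given exactly one direction), $S$ is locating-dominating in $D$ if the same holds with $N(\cdot)$ replaced by the in-neighbourhood $N^-_D(\cdot)$; $\gamma_{LD}(D)$ is the minimum size. $\overset{\rightarrow}{\Gamma}_{LD}(G)=\max_D\gamma_{LD}(D)$ over all orientations $D$ of $G$. Distinct vertices $u,v$ are twins if $N(u)=N(v)$ or $N[u]=N[v]$; a graph is twin-free if it has no twins. *)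

theory Defs
  imports Complex_Main "Graph_Theory.Pair_Digraph"
begin

text \<open>
  A finite simple undirected graph is a \<open>pair_graph\<close>: a finite loopless digraph without parallel
  arcs whose arc set is symmetric, so that the edge \<open>uv\<close> is the pair of arcs \<open>(u,v)\<close>, \<open>(v,u)\<close>.
\<close>

definition nbhd :: "'a pair_pre_digraph \<Rightarrow> 'a \<Rightarrow> 'a set" where
  "nbhd G u = {v. (u, v) \<in> parcs G}"

definition in_nbhd :: "'a pair_pre_digraph \<Rightarrow> 'a \<Rightarrow> 'a set" where
  "in_nbhd D u = {v. (v, u) \<in> parcs D}"

definition locating_dominating :: "'a set \<Rightarrow> ('a \<Rightarrow> 'a set) \<Rightarrow> 'a set \<Rightarrow> bool" where
  "locating_dominating V N S \<longleftrightarrow>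
     S \<subseteq> V \<and>
     (\<forall>u\<in>V - S. N u \<inter> S \<noteq> {}) \<and>
     (\<forall>u\<in>V - S. \<forall>v\<in>V - S. u \<noteq> v \<longrightarrow> N u \<inter> S \<noteq> N v \<inter> S)"

definition gamma_LD :: "'a pair_pre_digraph \<Rightarrow> nat" where
  "gamma_LD G = Min {card S | S. locating_dominating (pverts G) (nbhd G) S}"

definition dir_gamma_LD :: "'a pair_pre_digraph \<Rightarrow> nat" where
  "dir_gamma_LD D = Min {card S | S. locating_dominating (pverts D) (in_nbhd D) S}"

definition orientation_of :: "'a pair_pre_digraph \<Rightarrow> 'a pair_pre_digraph \<Rightarrow> bool" where
  "orientation_of G D \<longleftrightarrow>
     pverts D = pverts G \<and>
     parcs D \<subseteq> parcs G \<and>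
     (\<forall>(u, v)\<in>parcs G. ((u, v) \<in> parcs D) \<noteq> ((v, u) \<in> parcs D))"

definition upper_dir_gamma_LD :: "'a pair_pre_digraph \<Rightarrow> nat" where
  "upper_dir_gamma_LD G = Max {dir_gamma_LD D | D. orientation_of G D}"

definition twins :: "'a pair_pre_digraph \<Rightarrow> 'a \<Rightarrow> 'a \<Rightarrow> bool" where
  "twins G u v \<longleftrightarrow>
     u \<noteq> v \<and> (nbhd G u = nbhd G v \<or> insert u (nbhd G u) = insert v (nbhd G v))"

definition twin_free :: "'a pair_pre_digraph \<Rightarrow> bool" where
  "twin_free G \<longleftrightarrow> \<not> (\<exists>u\<in>pverts G. \<exists>v\<in>pverts G. twins G u v)"

text \<open>
  For finite graphs the sets under \<open>Min\<close> and \<open>Max\<close> above are finite and nonempty, so the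
  extrema are attained.
\<close>

lemma locating_dominating_cards:
  assumes "finite V"
  shows "finite {card S | S. locating_dominating V N S}"
    and "{card S | S. locating_dominating V N S} \<noteq> {}"
proof -
  have "{card S | S. locating_dominating V N S} \<subseteq> card ` Pow V"
    by (auto simp: locating_dominating_def)
  then show "finite {card S | S. locating_dominating V N S}"
    using assms by (meson finite_Pow_iff finite_imageI finite_subset)
  have "locating_dominating V N V"
    by (simp add: locating_dominating_def)
  then show "{card S | S. locating_dominating V N S} \<noteq> {}"
    by blast
qed

lemma orientation_values:
  assumes "pair_graph G"
  shows "finite {dir_gamma_LD D | D. orientation_of G D}"
    and "{dir_gamma_LD D | D. orientation_of G D} \<noteq> {}"
proof -
  interpret pair_graph G by fact
  have "{D. orientation_of G D} \<subseteq>
      (\<lambda>A. \<lparr>pverts = pverts G, parcs = A\<rparr>) ` Pow (parcs G)"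
  proof
    fix D assume "D \<in> {D. orientation_of G D}"
    then have "D = \<lparr>pverts = pverts G, parcs = parcs D\<rparr>" "parcs D \<in> Pow (parcs G)"
      by (auto simp: orientation_of_def)
    then show "D \<in> (\<lambda>A. \<lparr>pverts = pverts G, parcs = A\<rparr>) ` Pow (parcs G)"
      by blast
  qed
  then have "finite {D. orientation_of G D}"
    using pair_finite_arcs by (meson finite_Pow_iff finite_imageI finite_subset)
  then show "finite {dir_gamma_LD D | D. orientation_of G D}"
    by (rule finite_image_set)
  obtain f :: "'a \<Rightarrow> nat" where f: "inj_on f (pverts G)"
    using pair_finite_verts finite_imp_inj_to_nat_seg by blast
  have sym: "(u, v) \<in> parcs G \<Longrightarrow> (v, u) \<in> parcs G" for u v
    using pair_sym_arcs unfolding symmetric_def by (simp add: symD)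
  have "orientation_of G
      \<lparr>pverts = pverts G, parcs = {(u, v). (u, v) \<in> parcs G \<and> f u < f v}\<rparr>"
  proof -
    have "f u < f v \<longleftrightarrow> \<not> f v < f u" if "(u, v) \<in> parcs G" for u v
    proof -
      have "f u \<noteq> f v"
        using inj_onD[OF f, of u v] pair_no_loops[OF that] in_arcsD1[OF that] in_arcsD2[OF that]
        by simp blast
      then show ?thesis by linarith
    qed
    moreover note sym
    ultimately have "((u, v) \<in> parcs G \<and> f u < f v) \<noteq> ((v, u) \<in> parcs G \<and> f v < f u)"
      if "(u, v) \<in> parcs G" for u v
      using that by blast
    then have "\<forall>(u, v)\<in>parcs G.
        ((u, v) \<in> parcs G \<and> f u < f v) \<noteq> ((v, u) \<in> parcs G \<and> f v < f u)"
      by blast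
    then show ?thesis
      by (simp only: orientation_of_def pair_pre_digraph.simps mem_Collect_eq case_prod_conv) blast
  qed
  then show "{dir_gamma_LD D | D. orientation_of G D} \<noteq> {}"
    by blast
qed

end

theory Submission
  imports Defs "HOL-Real_Asymp.Real_Asymp"
begin

text \<open>
  Join a clique on \<open>q\<^sup>2\<close> vertices to a \<open>q \<times> q\<close> rook's graph by a perfect matching. Two
  matching edges that both miss \<open>S\<close> would leave two clique vertices with the same trace on \<open>S\<close>,
  so \<open>\<gamma>\<^sub>L\<^sub>D\<close> is \<open>q\<^sup>2\<close> up to \<open>1\<close>. In every orientation the clique is a tournament, which half of its
  vertices locate, and a transitive tournament needs half of its vertices. The rook's graph is
  cheap: each row and each column is a tournament with a doubly dominating set of size
  \<open>O(log q)\<close>, and a cell is determined by two in-neighbours in its row and two in its column.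
  Hence the orientations cost at most \<open>q\<^sup>2 / 2 + O(q log q)\<close>.

  A tournament is located by half of its vertices through a parity argument: for a minimal nonempty
  \<open>P\<close> with an odd number of common out-neighbours, every nonempty subset of \<open>P\<close> is the set of
  in-neighbours in \<open>P\<close> of an odd number of vertices. At least \<open>|P|\<close> of the classes into which \<open>P\<close>
  splits the other vertices are then odd, and the halves lost to rounding in these classes pay
  for \<open>P\<close>.
\<close>

section \<open>Locating sets of tournaments\<close>

text \<open>The relation stays fixed while only the vertex set varies, so that inductions can pass
  to subsets of a tournament.\<close>

definition tournament_on :: "'a set \<Rightarrow> ('a \<Rightarrow> 'a \<Rightarrow> bool) \<Rightarrow> bool" where
  "tournament_on V r \<longleftrightarrow>
     (\<forall>x\<in>V. \<not> r x x) \<and> (\<forall>x\<in>V. \<forall>y\<in>V. x \<noteq> y \<longrightarrow> r x y \<noteq> r y x)"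

lemma tournament_on_subset: "tournament_on V r \<Longrightarrow> W \<subseteq> V \<Longrightarrow> tournament_on W r"
  unfolding tournament_on_def by blast

text \<open>With \<open>B = {}\<close> these are the common out-neighbours of \<open>A\<close>; with
  \<open>B = P - A\<close> they are the vertices whose set of in-neighbours in \<open>P\<close> is
  exactly \<open>A\<close>, members of \<open>P\<close> included.\<close>

definition pattern :: "'a set \<Rightarrow> ('a \<Rightarrow> 'a \<Rightarrow> bool) \<Rightarrow> 'a set \<Rightarrow> 'a set \<Rightarrow> 'a set" where
  "pattern V r A B = {v \<in> V. (\<forall>x\<in>A. r x v) \<and> (\<forall>x\<in>B. \<not> r x v)}"

text \<open>This is inclusion-exclusion modulo 2: the parity is the sum over all \<open>Q\<close>
  with \<open>A \<subseteq> Q \<subseteq> A \<union> B\<close> of the numbers of common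
  out-neighbours of \<open>Q\<close>, and only \<open>Q = P\<close> can contribute an odd term. The
  induction removes one element of \<open>B\<close> at a time.\<close>

lemma odd_pattern_iff:
  assumes "finite V" "finite B" "A \<noteq> {}" "A \<inter> B = {}" "A \<union> B \<subseteq> P"
    and "\<And>Q. Q \<noteq> {} \<Longrightarrow> Q \<subset> P \<Longrightarrow> even (card (pattern V r Q {}))"
  shows "odd (card (pattern V r A B)) \<longleftrightarrow> A \<union> B = P \<and> odd (card (pattern V r P {}))"
  using assms(2-5)
proof (induction B arbitrary: A)
  case empty
  then show ?case
    using assms(6)[of A] by auto
next
  case (insert b B)
  have split: "pattern V r A B = pattern V r A (insert b B) \<union> pattern V r (insert b A) B"
    unfolding pattern_def by blast
  have "card (pattern V r A B) = card (pattern V r A (insert b B)) + card (pattern V r (insert b A) B)"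
    unfolding split
    by (rule card_Un_disjoint) (use assms(1) in \<open>auto simp: pattern_def\<close>)
  moreover have "odd (card (pattern V r A B)) \<longleftrightarrow> A \<union> B = P \<and> odd (card (pattern V r P {}))"
    using insert.prems by (intro insert.IH) auto
  moreover have "odd (card (pattern V r (insert b A) B)) \<longleftrightarrow>
      insert b A \<union> B = P \<and> odd (card (pattern V r P {}))"
    using insert.prems insert.hyps by (intro insert.IH) auto
  \<comment> \<open>The element \<open>b\<close> is missing, so the class that is being split is
    even and its two halves have equal parity.\<close>
  moreover have "A \<union> B \<noteq> P"
    using insert.prems insert.hyps by blast
  ultimately show ?case
    by auto
qed

text \<open>If every such count were even, then, with \<open>P = V\<close> in
  \<open>odd_pattern_iff\<close>, every nonempty set would be the full in-neighbourhood of an even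
  number of vertices. The head of any arc contradicts this.\<close>

lemma ex_odd_pattern:
  assumes "tournament_on V r" "finite V" "2 \<le> card V"
  shows "\<exists>Q\<subseteq>V. Q \<noteq> {} \<and> odd (card (pattern V r Q {}))"
proof (rule ccontr)
  assume *: "\<not> ?thesis"
  obtain x y where xy: "x \<in> V" "y \<in> V" "x \<noteq> y"
    using assms(2,3) card_le_Suc0_iff_eq[of V] by fastforce
  then obtain v where v: "v \<in> V" "{u \<in> V. r u v} \<noteq> {}"
    using assms(1) unfolding tournament_on_def by blast
  define A where "A = {u \<in> V. r u v}"
  \<comment> \<open>Of two vertices with the same in-neighbourhood one would dominate the other, and
    hence itself.\<close>
  have "pattern V r A (V - A) = {v}"
    using assms(1) v unfolding pattern_def A_def tournament_on_def by blast
  moreover have "odd (card (pattern V r A (V - A))) \<longleftrightarrow>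
      A \<union> (V - A) = V \<and> odd (card (pattern V r V {}))"
    using assms(2) v * by (intro odd_pattern_iff) (auto simp: A_def)
  ultimately show False
    using * v by auto
qed

lemma double_less_two_power: "3 \<le> n \<Longrightarrow> 2 * n + 1 \<le> (2::nat) ^ n"
  by (induction n rule: dec_induct) auto

text \<open>Choose \<open>P\<close> of least size with an odd number of common out-neighbours. Then
  every nonempty \<open>A \<subseteq> P\<close> has an odd class, and deleting \<open>P\<close> from
  the classes affects only those \<open>A\<close> that are traces of members of \<open>P\<close>.
  Enough other subsets remain.\<close>

lemma ex_odd_classes:
  assumes T: "tournament_on V r" and fin: "finite V" and two: "2 \<le> card V"
  shows "\<exists>P\<subseteq>V. P \<noteq> {} \<and> card P \<le> card {A \<in> Pow P. odd (card (pattern V r A (P - A) - P))}"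
proof -
  define good where "good Q \<longleftrightarrow> Q \<subseteq> V \<and> Q \<noteq> {} \<and> odd (card (pattern V r Q {}))" for Q
  obtain Q where "good Q"
    using ex_odd_pattern[OF assms] unfolding good_def by blast
  then obtain P where P: "good P" and min: "\<And>Q. good Q \<Longrightarrow> card P \<le> card Q"
    using ex_has_least_nat[of good Q card] by blast
  have PV: "P \<subseteq> V" "P \<noteq> {}" and oddP: "odd (card (pattern V r P {}))"
    using P unfolding good_def by auto
  have finP: "finite P"
    using PV fin finite_subset by blast
  have odd: "odd (card (pattern V r A (P - A)))" if "A \<noteq> {}" "A \<subseteq> P" for A
  proof -
    have "even (card (pattern V r Q {}))" if "Q \<noteq> {}" "Q \<subset> P" for Q
      using min[of Q] psubset_card_mono[OF finP that(2)] that PV unfolding good_def by fastforce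
    then have "odd (card (pattern V r A (P - A))) \<longleftrightarrow>
        A \<union> (P - A) = P \<and> odd (card (pattern V r P {}))"
      using fin finP that by (intro odd_pattern_iff) auto
    then show ?thesis
      using that oddP by auto
  qed
  define trace where "trace p = {x \<in> P. r x p}" for p
  \<comment> \<open>These are the nonempty subsets of \<open>P\<close> whose classes contain no
    member of \<open>P\<close>, so their odd size survives the deletion of \<open>P\<close>.\<close>
  define Z where "Z = Pow P - insert {} (trace ` P)"
  define O' where "O' = {A \<in> Pow P. odd (card (pattern V r A (P - A) - P))}"
  have "Z \<subseteq> O'"
  proof
    fix A assume A: "A \<in> Z"
    have "pattern V r A (P - A) \<inter> P = {}"
      using A unfolding pattern_def Z_def trace_def by auto
    then have "pattern V r A (P - A) - P = pattern V r A (P - A)"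
      by blast
    then show "A \<in> O'"
      using odd[of A] A unfolding O'_def Z_def by auto
  qed
  moreover have "finite O'"
    unfolding O'_def using finP by auto
  ultimately have ZO: "card Z \<le> card O'"
    by (rule card_mono[rotated])
  have "card P \<le> card Z"
  proof -
    have cZ: "card Z = 2 ^ card P - card (insert {} (trace ` P))"
      unfolding Z_def using finP
      by (subst card_Diff_subset) (auto simp: card_Pow trace_def)
    have "card P \<noteq> 0"
      using finP PV by simp
    then consider "card P = 1" | "card P = 2" | "3 \<le> card P"
      by linarith
    then show ?thesis
    proof cases
      case 1
      then obtain x where x: "P = {x}"
        by (rule card_1_singletonE)
      have "insert {} (trace ` P) = {{}}"
        using x PV T unfolding trace_def tournament_on_def by auto
      then show ?thesis
        using cZ 1 by (simp only:) simp
    next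
      case 2
      then obtain x y where xy: "P = {x, y}" "x \<noteq> y"
        by (auto simp: card_2_iff)
      \<comment> \<open>For one or two vertices the crude bound of \<open>card P + 1\<close>
        excluded sets is too weak. Here a single arc joins \<open>x\<close> and \<open>y\<close>, so
        its tail has an empty trace and only two sets are excluded.\<close>
      have "trace x = {} \<or> trace y = {}"
        using xy PV T unfolding trace_def tournament_on_def by auto
      then have "insert {} (trace ` P) \<subseteq> {{}, trace x \<union> trace y}"
        using xy by auto
      then have "card (insert {} (trace ` P)) \<le> card {{}, trace x \<union> trace y}"
        by (intro card_mono) auto
      also have "\<dots> \<le> 2"
        by (simp add: card_insert_if)
      finally show ?thesis
        using cZ 2 by simp
    next
      case 3
      have "card (insert {} (trace ` P)) \<le> Suc (card P)"
        using finP card_image_le[OF finP, of trace] by (simp add: card_insert_if)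
      then show ?thesis
        using cZ double_less_two_power[OF 3] by linarith
    qed
  qed
  then show ?thesis
    using ZO PV unfolding O'_def by (meson le_trans)
qed

text \<open>Put \<open>P\<close> from \<open>ex_odd_classes\<close> into \<open>S\<close> and
  recurse into the classes of the remaining vertices by their traces on \<open>P\<close>. Vertices
  of different classes are separated by \<open>P\<close>, those of one class by its recursive set.
  Domination is not claimed: at most one vertex outside \<open>S\<close> can have an empty
  trace.\<close>

lemma tournament_locating_set:
  assumes "tournament_on V r" "finite V"
  shows "\<exists>S\<subseteq>V. 2 * card S \<le> card V \<and> inj_on (\<lambda>v. {x \<in> S. r x v}) (V - S)"
  using assms
proof (induction "card V" arbitrary: V rule: less_induct)
  case less
  show ?case
  proof (cases "2 \<le> card V")
    case False
    then have "card V \<le> Suc 0"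
      by simp
    then have "inj_on (\<lambda>v. {x \<in> {}. r x v}) (V - {})"
      using less.prems(2) by (auto simp: card_le_Suc0_iff_eq inj_on_def)
    then show ?thesis
      by (intro exI[of _ "{}"]) auto
  next
    case True
    obtain P where P: "P \<subseteq> V" "P \<noteq> {}"
      and oddP: "card P \<le> card {A \<in> Pow P. odd (card (pattern V r A (P - A) - P))}"
      using ex_odd_classes[OF less.prems True] by blast
    have finP: "finite P"
      using P less.prems finite_subset by blast
    define K where "K A = pattern V r A (P - A) - P" for A
    have KV: "K A \<subseteq> V - P" for A
      unfolding K_def pattern_def by auto
    have "\<exists>S\<subseteq>K A. 2 * card S \<le> card (K A) \<and> inj_on (\<lambda>v. {x \<in> S. r x v}) (K A - S)" for A
    proof (rule less.hyps)
      show "card (K A) < card V"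
        using KV[of A] P less.prems by (intro psubset_card_mono) auto
      show "tournament_on (K A) r"
        using KV[of A] less.prems by (blast intro: tournament_on_subset)
      show "finite (K A)"
        using KV[of A] less.prems by (meson finite_Diff finite_subset)
    qed
    then obtain f where f: "\<And>A. f A \<subseteq> K A" "\<And>A. 2 * card (f A) \<le> card (K A)"
        "\<And>A. inj_on (\<lambda>v. {x \<in> f A. r x v}) (K A - f A)"
      by metis
    define S where "S = P \<union> (\<Union>A\<in>Pow P. f A)"
    have finK: "finite (K A)" for A
      using KV[of A] less.prems by (meson finite_Diff finite_subset)
    have in_K: "v \<in> K {x \<in> P. r x v}" if "v \<in> V - P" for v
      using that unfolding K_def pattern_def by auto
    have K_only: "A = {x \<in> P. r x v}" if "v \<in> K A" "A \<subseteq> P" for A v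
      using that unfolding K_def pattern_def by auto
    have "V - P = (\<Union>A\<in>Pow P. K A)"
    proof (rule set_eqI)
      fix v show "v \<in> V - P \<longleftrightarrow> v \<in> (\<Union>A\<in>Pow P. K A)"
        using in_K[of v] KV by (auto intro!: bexI[of _ "{x \<in> P. r x v}"])
    qed
    moreover have "card (\<Union>A\<in>Pow P. K A) = (\<Sum>A\<in>Pow P. card (K A))"
    proof (rule card_UN_disjoint)
      show "\<forall>A\<in>Pow P. \<forall>B\<in>Pow P. A \<noteq> B \<longrightarrow> K A \<inter> K B = {}"
        using K_only by blast
    qed (use finP finK in auto)
    ultimately have cV: "card V - card P = (\<Sum>A\<in>Pow P. card (K A))"
      using card_Diff_subset[OF finP P(1)] by simp
    \<comment> \<open>An odd class cannot be used up by an even number, so it leaves one unit over.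
      At least \<open>card P\<close> classes are odd, which supplies the second copy of
      \<open>card P\<close> needed for \<open>2 * card S\<close>.\<close>
    have "2 * card (f A) + (if odd (card (K A)) then 1 else 0) \<le> card (K A)" for A
      using f(2)[of A] by auto presburger
    then have "(\<Sum>A\<in>Pow P. 2 * card (f A) + (if odd (card (K A)) then 1 else 0)) \<le> (\<Sum>A\<in>Pow P. card (K A))"
      by (intro sum_mono)
    moreover have "(\<Sum>A\<in>Pow P. if odd (card (K A)) then 1 else 0) = card {A \<in> Pow P. odd (card (K A))}"
      using finP by (simp add: sum.If_cases Int_def)
    ultimately have "2 * (\<Sum>A\<in>Pow P. card (f A)) + card P \<le> card V - card P"
      using cV oddP unfolding K_def[symmetric] by (simp add: sum.distrib sum_distrib_left)
    moreover have "card S \<le> card P + (\<Sum>A\<in>Pow P. card (f A))"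
      unfolding S_def using card_Un_le[of P "\<Union>(f ` Pow P)"] card_UN_le[of "Pow P" f] finP
      by simp
    moreover have "card P \<le> card V"
      using P less.prems by (simp add: card_mono)
    ultimately have "2 * card S \<le> card V"
      using finP P(2) by linarith
    moreover have "S \<subseteq> V"
      unfolding S_def using f(1) KV P by blast
    moreover have "inj_on (\<lambda>v. {x \<in> S. r x v}) (V - S)"
    proof (rule inj_onI)
      fix v w assume vw: "v \<in> V - S" "w \<in> V - S" and eq: "{x \<in> S. r x v} = {x \<in> S. r x w}"
      define A where "A = {x \<in> P. r x v}"
      have "A = {x \<in> P. r x w}" "A \<in> Pow P"
        using eq unfolding A_def S_def by blast+
      then have "v \<in> K A - f A" "w \<in> K A - f A"
        using in_K[of v] in_K[of w] vw unfolding A_def S_def by auto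
      moreover have "{x \<in> f A. r x v} = {x \<in> f A. r x w}"
        using eq \<open>A \<in> Pow P\<close> unfolding S_def by blast
      ultimately show "v = w"
        using f(3)[of A] by (auto dest: inj_onD)
    qed
    ultimately show ?thesis
      by blast
  qed
qed

section \<open>Dominating and doubly dominating sets of tournaments\<close>

text \<open>Both sums count the arcs inside \<open>W\<close>.\<close>

lemma sum_out_in_degrees:
  assumes "tournament_on W r" "finite W"
  shows "(\<Sum>x\<in>W. card {y \<in> W. r x y}) = (\<Sum>x\<in>W. card {y \<in> W. r y x})"
proof -
  have "(\<Sum>x\<in>W. card {y \<in> W. r x y}) = (\<Sum>x\<in>W. \<Sum>y\<in>W. if r x y then 1 else 0)"
    using assms(2) by (simp add: sum.If_cases Int_def)
  also have "\<dots> = (\<Sum>y\<in>W. \<Sum>x\<in>W. if r x y then 1 else 0)"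
    by (rule sum.swap)
  also have "\<dots> = (\<Sum>x\<in>W. card {y \<in> W. r y x})"
    using assms(2) by (simp add: sum.If_cases Int_def)
  finally show ?thesis .
qed

lemma ex_large_out_degree:
  assumes "tournament_on W r" "finite W" "W \<noteq> {}"
  shows "\<exists>x\<in>W. card {y \<in> W. r y x} \<le> card {y \<in> W. r x y}"
proof (rule ccontr)
  assume "\<not> ?thesis"
  then have "(\<Sum>x\<in>W. card {y \<in> W. r x y}) < (\<Sum>x\<in>W. card {y \<in> W. r y x})"
    using assms by (intro sum_strict_mono) auto
  then show False
    using sum_out_in_degrees[OF assms(1,2)] by simp
qed

text \<open>A vertex whose out-degree is at least its in-degree leaves fewer than half of the
  vertices undominated, namely its in-neighbours, and the induction continues on these.\<close>

lemma tournament_dominating_set: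
  assumes "tournament_on W r" "finite W" "card W < 2 ^ n"
  shows "\<exists>T\<subseteq>W. card T \<le> n \<and> (\<forall>v\<in>W - T. \<exists>x\<in>T. r x v)"
  using assms
proof (induction n arbitrary: W)
  case 0
  then show ?case by auto
next
  case (Suc n)
  show ?case
  proof (cases "W = {}")
    case False
    obtain x where x: "x \<in> W" "card {y \<in> W. r y x} \<le> card {y \<in> W. r x y}"
      using ex_large_out_degree[OF Suc.prems(1,2) False] by blast
    define I where "I = {y \<in> W. r y x}"
    define J where "J = {y \<in> W. r x y}"
    have "W - {x} = I \<union> J"
      using Suc.prems(1) x(1) unfolding I_def J_def tournament_on_def by auto
    moreover have "I \<inter> J = {}"
    proof -
      have "\<not> (r x y \<and> r y x)" if "y \<in> W" for y
        using Suc.prems(1) x(1) that unfolding tournament_on_def by metis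
      then show ?thesis
        unfolding I_def J_def by blast
    qed
    ultimately have IJ: "W - {x} = I \<union> J" "I \<inter> J = {}"
      by auto
    have "I \<subseteq> W"
      unfolding I_def by blast
    have fin: "finite I" "finite J"
      using Suc.prems(2) unfolding I_def J_def by auto
    have "card W = Suc (card (I \<union> J))"
      using card_Suc_Diff1[OF Suc.prems(2) x(1)] IJ(1) by metis
    also have "card (I \<union> J) = card I + card J"
      using fin IJ(2) by (rule card_Un_disjoint)
    finally have "card W = Suc (card I + card J)" .
    then have "card I < 2 ^ n"
      using x(2) Suc.prems(3) unfolding I_def J_def by simp
    then obtain T where T: "T \<subseteq> I" "card T \<le> n" "\<forall>v\<in>I - T. \<exists>x\<in>T. r x v"
      using Suc.IH[OF tournament_on_subset[OF Suc.prems(1) \<open>I \<subseteq> W\<close>] fin(1)] by blast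
    have "card (insert x T) \<le> Suc n"
      using T(2) finite_subset[OF T(1) fin(1)] by (simp add: card_insert_if)
    moreover have "\<forall>v\<in>W - insert x T. \<exists>x\<in>insert x T. r x v"
      using T(3) IJ(1) unfolding J_def by blast
    ultimately show ?thesis
      using T(1) \<open>I \<subseteq> W\<close> x(1) by (intro exI[of _ "insert x T"]) auto
  qed auto
qed

text \<open>Take a dominating set \<open>T\<close> and then a dominating set \<open>U\<close> of
  what is left. As \<open>T\<close> and \<open>U\<close> are disjoint, they provide two different
  in-neighbours.\<close>

lemma tournament_double_dominating_set:
  assumes "tournament_on W r" "finite W" "card W < 2 ^ n"
  shows "\<exists>T\<subseteq>W. card T \<le> 2 * n \<and> (\<forall>v\<in>W - T. \<exists>x\<in>T. \<exists>y\<in>T. x \<noteq> y \<and> r x v \<and> r y v)"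
proof -
  obtain T where T: "T \<subseteq> W" "card T \<le> n" "\<forall>v\<in>W - T. \<exists>x\<in>T. r x v"
    using tournament_dominating_set[OF assms] by blast
  have "card (W - T) < 2 ^ n"
    using assms(2,3) by (meson Diff_subset card_mono le_less_trans)
  then obtain U where U: "U \<subseteq> W - T" "card U \<le> n" "\<forall>v\<in>W - T - U. \<exists>x\<in>U. r x v"
    using tournament_dominating_set[of "W - T" r n] assms(1,2) tournament_on_subset[of W r "W - T"]
    by auto
  have "card (T \<union> U) \<le> 2 * n"
    using card_Un_le[of T U] T(2) U(2) by linarith
  moreover have "\<exists>x\<in>T \<union> U. \<exists>y\<in>T \<union> U. x \<noteq> y \<and> r x v \<and> r y v" if "v \<in> W - (T \<union> U)" for v
  proof -
    have "v \<in> W - T" "v \<in> W - T - U"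
      using that by auto
    then obtain x y where xy: "x \<in> T" "r x v" "y \<in> U" "r y v"
      using T(3) U(3) by meson
    then have "x \<noteq> y"
      using U(1) by auto
    with xy show ?thesis
      by (intro bexI[of _ x] bexI[of _ y]) auto
  qed
  ultimately show ?thesis
    using T(1) U(1) by (intro exI[of _ "T \<union> U"]) auto
qed

section \<open>The clique joined to a rook's graph\<close>

text \<open>
  Cell \<open>(a, b)\<close> of the rook's graph is the number \<open>q\<^sup>2 + a * q + b\<close>, so the offset \<open>q\<^sup>2\<close> changes
  neither the remainder modulo \<open>q\<close> nor whether two quotients by \<open>q\<close> agree.
\<close>

definition clique_rook_adj :: "nat \<Rightarrow> nat \<Rightarrow> nat \<Rightarrow> bool" where
  "clique_rook_adj q u v \<longleftrightarrow> u \<noteq> v \<and>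
     (u < q\<^sup>2 \<and> v < q\<^sup>2 \<or> u = v + q\<^sup>2 \<or> v = u + q\<^sup>2 \<or>
      q\<^sup>2 \<le> u \<and> q\<^sup>2 \<le> v \<and> (u div q = v div q \<or> u mod q = v mod q))"

definition clique_rook :: "nat \<Rightarrow> nat pair_pre_digraph" where
  "clique_rook q = \<lparr>pverts = {..<2 * q\<^sup>2},
     parcs = {(u, v). u < 2 * q\<^sup>2 \<and> v < 2 * q\<^sup>2 \<and> clique_rook_adj q u v}\<rparr>"

lemma pair_graph_clique_rook: "pair_graph (clique_rook q)"
proof
  show "finite (parcs (clique_rook q))"
    by (rule finite_subset[of _ "{..<2 * q\<^sup>2} \<times> {..<2 * q\<^sup>2}"]) (auto simp: clique_rook_def)
  show "symmetric (with_proj (clique_rook q))"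
    unfolding symmetric_def by (auto simp: clique_rook_def clique_rook_adj_def sym_def)
qed (auto simp: clique_rook_def clique_rook_adj_def)

text \<open>The right-hand side does not depend on \<open>i\<close>, so a locating set can miss at
  most one matching edge entirely.\<close>

lemma nbhd_clique_Int:
  assumes "i < q\<^sup>2" "i \<notin> S" "i + q\<^sup>2 \<notin> S"
  shows "nbhd (clique_rook q) i \<inter> S = {..<q\<^sup>2} \<inter> S"
  using assms by (auto simp: nbhd_def clique_rook_def clique_rook_adj_def)

lemma nbhd_clique_Int_rook:
  "i < q\<^sup>2 \<Longrightarrow> nbhd (clique_rook q) i \<inter> {q\<^sup>2..<2 * q\<^sup>2} = {i + q\<^sup>2}"
  by (auto simp: nbhd_def clique_rook_def clique_rook_adj_def)

lemma nbhd_rook_Int_clique: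
  "j < q\<^sup>2 \<Longrightarrow> nbhd (clique_rook q) (j + q\<^sup>2) \<inter> {..<q\<^sup>2} = {j}"
  by (auto simp: nbhd_def clique_rook_def clique_rook_adj_def)

text \<open>Two vertices on the same side have different matching partners. A clique vertex and a
  rook vertex differ because the former has at least three neighbours in the clique and the latter
  only one.\<close>

lemma twin_free_clique_rook:
  assumes "2 \<le> q"
  shows "twin_free (clique_rook q)"
proof -
  define m where "m = q\<^sup>2"
  have m4: "4 \<le> m"
    using power_mono[OF assms, of 2] by (simp add: m_def)
  let ?N = "nbhd (clique_rook q)"
  have verts: "pverts (clique_rook q) = {..<2 * m}"
    by (simp add: clique_rook_def m_def)
  have L: "insert i (?N i) \<inter> {m..<2 * m} = {i + m}" "?N i \<inter> {m..<2 * m} = {i + m}" if "i < m" for i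
    using nbhd_clique_Int_rook[of i q] that by (auto simp: m_def)
  have C: "insert (j + m) (?N (j + m)) \<inter> {..<m} = {j}" "?N (j + m) \<inter> {..<m} = {j}" if "j < m" for j
    using nbhd_rook_Int_clique[of j q] that by (auto simp: m_def)
  have split: "\<exists>j<m. u = j + m" if "u < 2 * m" "\<not> u < m" for u
    using that by (intro exI[of _ "u - m"]) auto
  have mixed: "\<not> twins (clique_rook q) i (j + m)" if ij: "i < m" "j < m" for i j
  proof -
    have "card ({..<m} - {i}) = m - 1"
      using ij by simp
    moreover have "{..<m} - {i} \<subseteq> ?N i"
      using ij by (auto simp: nbhd_def clique_rook_def clique_rook_adj_def m_def)
    moreover have "\<not> {..<m} - {i} \<subseteq> {j}"
      using m4 card_mono[of "{j}" "{..<m} - {i}"] \<open>card ({..<m} - {i}) = m - 1\<close> by auto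
    ultimately have "\<not> ?N i \<inter> {..<m} \<subseteq> {j}"
      by blast
    then show ?thesis
      using C[OF ij(2)] unfolding twins_def by blast
  qed
  show ?thesis
    unfolding twin_free_def verts
  proof (intro notI, elim bexE)
    fix u v assume uv: "u \<in> {..<2 * m}" "v \<in> {..<2 * m}" and tw: "twins (clique_rook q) u v"
    have tw': "twins (clique_rook q) v u"
      using tw unfolding twins_def by metis
    show False
    proof (cases "u < m"; cases "v < m")
      assume "u < m" "v < m"
      then show False
        using L[of u] L[of v] tw unfolding twins_def by (metis add_right_cancel singleton_inject)
    next
      assume "\<not> u < m" "\<not> v < m"
      then obtain i j where "i < m" "u = i + m" "j < m" "v = j + m"
        using split uv by (metis lessThan_iff)
      then show False
        using C[of i] C[of j] tw unfolding twins_def by (metis singleton_inject)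
    next
      assume "u < m" "\<not> v < m"
      then show False
        using mixed split uv tw by (metis lessThan_iff)
    next
      assume "\<not> u < m" "v < m"
      then show False
        using mixed split uv tw' by (metis lessThan_iff)
    qed
  qed
qed

section \<open>The undirected locating-domination number\<close>

lemma gamma_LD_le:
  assumes "finite (pverts G)" "locating_dominating (pverts G) (nbhd G) S"
  shows "gamma_LD G \<le> card S"
  unfolding gamma_LD_def using assms locating_dominating_cards(1)
  by (intro Min_le) auto

lemma gamma_LD_attained:
  assumes "finite (pverts G)"
  obtains S where "locating_dominating (pverts G) (nbhd G) S" "gamma_LD G = card S"
  using Min_in[OF locating_dominating_cards[OF assms, of "nbhd G"]]
  unfolding gamma_LD_def by blast

lemma dir_gamma_LD_le:
  assumes "finite (pverts D)" "locating_dominating (pverts D) (in_nbhd D) S"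
  shows "dir_gamma_LD D \<le> card S"
  unfolding dir_gamma_LD_def using assms locating_dominating_cards(1)
  by (intro Min_le) auto

lemma dir_gamma_LD_attained:
  assumes "finite (pverts D)"
  obtains S where "locating_dominating (pverts D) (in_nbhd D) S" "dir_gamma_LD D = card S"
  using Min_in[OF locating_dominating_cards[OF assms, of "in_nbhd D"]]
  unfolding dir_gamma_LD_def by blast

text \<open>The whole rook side works: each clique vertex sees exactly its own partner
  there.\<close>

lemma gamma_LD_clique_rook_upper: "gamma_LD (clique_rook q) \<le> q\<^sup>2"
proof -
  let ?C = "{q\<^sup>2..<2 * q\<^sup>2}"
  have "locating_dominating {..<2 * q\<^sup>2} (nbhd (clique_rook q)) ?C"
    unfolding locating_dominating_def using nbhd_clique_Int_rook[of _ q] by auto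
  then have "gamma_LD (clique_rook q) \<le> card ?C"
    by (intro gamma_LD_le) (auto simp: clique_rook_def)
  then show ?thesis
    by simp
qed

lemma gamma_LD_clique_rook_lower: "q\<^sup>2 \<le> gamma_LD (clique_rook q) + 1"
proof -
  define m where "m = q\<^sup>2"
  obtain S where S: "locating_dominating {..<2 * m} (nbhd (clique_rook q)) S"
    and card_S: "gamma_LD (clique_rook q) = card S"
    using gamma_LD_attained[of "clique_rook q"] by (auto simp: clique_rook_def m_def)
  have "S \<subseteq> {..<2 * m}"
    using S unfolding locating_dominating_def by blast
  then have fin: "finite S"
    using finite_subset by blast
  define A where "A = {i. i < m \<and> i \<notin> S \<and> i + m \<notin> S}"
  have "finite A"
    unfolding A_def by auto
  have "i = j" if "i \<in> A" "j \<in> A" for i j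
  proof (rule ccontr)
    assume "i \<noteq> j"
    moreover have "i \<in> {..<2 * m} - S" "j \<in> {..<2 * m} - S"
      using that unfolding A_def by auto
    ultimately have "nbhd (clique_rook q) i \<inter> S \<noteq> nbhd (clique_rook q) j \<inter> S"
      using S unfolding locating_dominating_def by blast
    then show False
      using nbhd_clique_Int[of i q S] nbhd_clique_Int[of j q S] that unfolding A_def m_def by auto
  qed
  then have "card A \<le> Suc 0"
    using \<open>finite A\<close> by (auto simp: card_le_Suc0_iff_eq)
  define S1 where "S1 = S \<inter> {..<m}"
  define S2 where "S2 = S - {..<m}"
  \<comment> \<open>Each matching edge outside \<open>A\<close> is charged to one of its endpoints
    in \<open>S\<close>; distinct edges have distinct endpoints.\<close>
  have "{..<m} \<subseteq> A \<union> S1 \<union> (\<lambda>x. x - m) ` S2"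
    unfolding A_def S1_def S2_def by force
  then have "m \<le> card (A \<union> S1 \<union> (\<lambda>x. x - m) ` S2)"
    using card_mono[of "A \<union> S1 \<union> (\<lambda>x. x - m) ` S2" "{..<m}"] \<open>finite A\<close> fin
    by (simp add: S1_def S2_def)
  also have "\<dots> \<le> card A + card S1 + card S2"
    using card_Un_le[of "A \<union> S1" "(\<lambda>x. x - m) ` S2"] card_Un_le[of A S1]
      card_image_le[of S2 "\<lambda>x. x - m"] fin by (simp add: S2_def)
  also have "card A + card S1 + card S2 = card A + card S"
    using card_Int_Diff[OF fin, of "{..<m}"] by (simp add: S1_def S2_def)
  finally show ?thesis
    using \<open>card A \<le> Suc 0\<close> card_S unfolding m_def by simp
qed

section \<open>Lower bound from a transitive orientation\<close>

lemma upper_dir_gamma_LD_ge: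
  assumes "pair_graph G" "orientation_of G D"
  shows "dir_gamma_LD D \<le> upper_dir_gamma_LD G"
  unfolding upper_dir_gamma_LD_def using assms orientation_values(1)
  by (intro Max_ge) auto

lemma upper_dir_gamma_LD_attained:
  assumes "pair_graph G"
  obtains D where "orientation_of G D" "upper_dir_gamma_LD G = dir_gamma_LD D"
  using Max_in[OF orientation_values[OF assms]] unfolding upper_dir_gamma_LD_def by blast

text \<open>
  Orienting every edge upwards makes the clique a transitive tournament in which two
  consecutive vertices differ only in the earlier of them.
\<close>

lemma upper_dir_gamma_LD_clique_rook_lower: "q\<^sup>2 \<le> 2 * upper_dir_gamma_LD (clique_rook q) + 1"
proof -
  define m where "m = q\<^sup>2"
  define D where "D = \<lparr>pverts = pverts (clique_rook q),
    parcs = {(u, v). (u, v) \<in> parcs (clique_rook q) \<and> u < v}\<rparr>"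
  have "orientation_of (clique_rook q) D"
    unfolding orientation_of_def D_def by (auto simp: clique_rook_def clique_rook_adj_def)
  then have le: "dir_gamma_LD D \<le> upper_dir_gamma_LD (clique_rook q)"
    by (intro upper_dir_gamma_LD_ge pair_graph_clique_rook)
  obtain S where S: "locating_dominating {..<2 * m} (in_nbhd D) S" and card_S: "dir_gamma_LD D = card S"
    using dir_gamma_LD_attained[of D] by (auto simp: clique_rook_def D_def m_def)
  have "S \<subseteq> {..<2 * m}"
    using S unfolding locating_dominating_def by blast
  then have fin: "finite S"
    using finite_subset by blast
  \<comment> \<open>Rook vertices have larger numbers than clique vertices, so no arc enters the
    clique from outside.\<close>
  have N: "in_nbhd D i = {..<i}" if "i < m" for i
    using that by (auto simp: in_nbhd_def D_def clique_rook_def clique_rook_adj_def m_def)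
  have step: "i \<in> S \<or> Suc i \<in> S" if "Suc i < m" for i
  proof (rule ccontr)
    assume no: "\<not> ?thesis"
    then have "in_nbhd D i \<inter> S \<noteq> in_nbhd D (Suc i) \<inter> S"
      using S that unfolding locating_dominating_def by simp
    then show False
      using N[of i] N[of "Suc i"] that no by (auto simp: lessThan_Suc)
  qed
  \<comment> \<open>Every \<open>i\<close> below \<open>m - 1\<close> lies in \<open>S\<close> or
    has its successor there. Only \<open>m - 1\<close> has no successor in the clique, which costs
    the additive 1.\<close>
  have "{..<m} \<subseteq> insert (m - 1) (S \<union> (\<lambda>x. x - 1) ` S)"
  proof
    fix i assume i: "i \<in> {..<m}"
    show "i \<in> insert (m - 1) (S \<union> (\<lambda>x. x - 1) ` S)"
    proof (cases "Suc i < m")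
      case True
      then show ?thesis
        using step[OF True] by force
    qed (use i in auto)
  qed
  then have "m \<le> card (insert (m - 1) (S \<union> (\<lambda>x. x - 1) ` S))"
    using card_mono[of "insert (m - 1) (S \<union> (\<lambda>x. x - 1) ` S)" "{..<m}"] fin by simp
  also have "\<dots> \<le> Suc (card (S \<union> (\<lambda>x. x - 1) ` S))"
    using fin by (simp add: card_insert_if)
  also have "card (S \<union> (\<lambda>x. x - 1) ` S) \<le> 2 * card S"
    using card_Un_le[of S "(\<lambda>x. x - 1) ` S"] card_image_le[OF fin, of "\<lambda>x. x - 1"] by simp
  finally show ?thesis
    using le card_S unfolding m_def by simp
qed

section \<open>Upper bound for every orientation\<close>

lemma orientation_tournament_on:
  assumes "pair_graph G" "orientation_of G D"
    and "\<And>x y. x \<in> W \<Longrightarrow> y \<in> W \<Longrightarrow> x \<noteq> y \<Longrightarrow> (x, y) \<in> parcs G"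
  shows "tournament_on W (\<lambda>x y. (x, y) \<in> parcs D)"
proof -
  interpret pair_graph G by fact
  have "(x, x) \<notin> parcs D" for x
    using assms(2) pair_no_loops[of "(x, x)"] unfolding orientation_of_def by auto
  then show ?thesis
    using assms(2,3) unfolding tournament_on_def orientation_of_def by blast
qed

text \<open>Each of the \<open>q\<close> rows and \<open>q\<close> columns is oriented as a
  tournament on fewer than \<open>2 ^ n\<close> vertices and contributes a doubly dominating set of
  at most \<open>2 * n\<close> vertices.\<close>

lemma rook_double_dominating_set:
  assumes D: "orientation_of (clique_rook q) D" and n: "q < 2 ^ n"
  shows "\<exists>S\<subseteq>{q\<^sup>2..<2 * q\<^sup>2}. card S \<le> 4 * q * n \<and>
    (\<forall>v\<in>{q\<^sup>2..<2 * q\<^sup>2} - S.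
      (\<exists>x\<in>S. \<exists>y\<in>S. x \<noteq> y \<and> (x, v) \<in> parcs D \<and> (y, v) \<in> parcs D \<and>
         x div q = v div q \<and> y div q = v div q) \<and>
      (\<exists>x\<in>S. \<exists>y\<in>S. x \<noteq> y \<and> (x, v) \<in> parcs D \<and> (y, v) \<in> parcs D \<and>
         x mod q = v mod q \<and> y mod q = v mod q))"
proof (cases "q = 0")
  case False
  define r where "r x y \<longleftrightarrow> (x, y) \<in> parcs D" for x y
  define C where "C = {q\<^sup>2..<2 * q\<^sup>2}"
  define row where "row a = {v \<in> C. v div q = a}" for a
  define col where "col b = {v \<in> C. v mod q = b}" for b
  \<comment> \<open>The cells start at \<open>q * q\<close>, so the row numbers start at
    \<open>q\<close> rather than 0.\<close>
  have div_C: "v div q \<in> {q..<2 * q}" if "v \<in> C" for v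
    using that False by (auto simp: C_def power2_eq_square div_less_iff_less_mult less_eq_div_iff_mult_less_eq mult.assoc)
  have "tournament_on (row a) r" for a
    unfolding r_def
    by (intro orientation_tournament_on[OF pair_graph_clique_rook D])
      (auto simp: row_def C_def clique_rook_def clique_rook_adj_def)
  moreover have "card (row a) < 2 ^ n" for a
  proof -
    have "inj_on (\<lambda>v. v mod q) (row a)"
      by (intro inj_onI) (metis (mono_tags, lifting) div_mult_mod_eq mem_Collect_eq row_def)
    then have "card (row a) \<le> card {..<q}"
      by (rule card_inj_on_le) (use False in auto)
    then show ?thesis
      using n by simp
  qed
  moreover have "finite (row a)" "finite (col a)" for a
    unfolding row_def col_def C_def by auto
  ultimately have "\<exists>T\<subseteq>row a. card T \<le> 2 * n \<and>
      (\<forall>v\<in>row a - T. \<exists>x\<in>T. \<exists>y\<in>T. x \<noteq> y \<and> r x v \<and> r y v)" for a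
    by (intro tournament_double_dominating_set) auto
  then obtain f where f: "\<And>a. f a \<subseteq> row a" "\<And>a. card (f a) \<le> 2 * n"
      "\<And>a v. v \<in> row a - f a \<Longrightarrow> \<exists>x\<in>f a. \<exists>y\<in>f a. x \<noteq> y \<and> r x v \<and> r y v"
    by metis
  have "tournament_on (col a) r" for a
    unfolding r_def
    by (intro orientation_tournament_on[OF pair_graph_clique_rook D])
      (auto simp: col_def C_def clique_rook_def clique_rook_adj_def)
  moreover have "card (col a) < 2 ^ n" for a
  proof -
    have "inj_on (\<lambda>v. v div q) (col a)"
      by (intro inj_onI) (metis (mono_tags, lifting) div_mult_mod_eq mem_Collect_eq col_def)
    then have "card (col a) \<le> card {q..<2 * q}"
      by (rule card_inj_on_le) (use div_C in \<open>auto simp: col_def\<close>)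
    then show ?thesis
      using n by simp
  qed
  moreover have "finite (col a)" for a
    unfolding col_def C_def by auto
  ultimately have "\<exists>T\<subseteq>col a. card T \<le> 2 * n \<and>
      (\<forall>v\<in>col a - T. \<exists>x\<in>T. \<exists>y\<in>T. x \<noteq> y \<and> r x v \<and> r y v)" for a
    by (intro tournament_double_dominating_set) auto
  then obtain g where g: "\<And>a. g a \<subseteq> col a" "\<And>a. card (g a) \<le> 2 * n"
      "\<And>a v. v \<in> col a - g a \<Longrightarrow> \<exists>x\<in>g a. \<exists>y\<in>g a. x \<noteq> y \<and> r x v \<and> r y v"
    by metis
  define S where "S = (\<Union>a\<in>{q..<2 * q}. f a) \<union> (\<Union>b<q. g b)"
  have "card (\<Union>a\<in>{q..<2 * q}. f a) \<le> (\<Sum>a\<in>{q..<2 * q}. card (f a))"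
    by (intro card_UN_le) auto
  also have "\<dots> \<le> 2 * q * n"
    using sum_bounded_above[of "{q..<2 * q}" "\<lambda>a. card (f a)" "2 * n"] f(2) by (simp add: mult_ac)
  finally have F: "card (\<Union>a\<in>{q..<2 * q}. f a) \<le> 2 * q * n" .
  have "card (\<Union>b<q. g b) \<le> (\<Sum>b<q. card (g b))"
    by (intro card_UN_le) auto
  also have "\<dots> \<le> 2 * q * n"
    using sum_bounded_above[of "{..<q}" "\<lambda>a. card (g a)" "2 * n"] g(2) by (simp add: mult_ac)
  finally have "card S \<le> 4 * q * n"
    using F card_Un_le[of "\<Union>a\<in>{q..<2 * q}. f a" "\<Union>b<q. g b"] unfolding S_def by linarith
  moreover have "S \<subseteq> C"
    using f(1) g(1) unfolding S_def row_def col_def by blast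
  moreover have "\<exists>x\<in>S. \<exists>y\<in>S. x \<noteq> y \<and> r x v \<and> r y v \<and> x div q = v div q \<and> y div q = v div q"
    if "v \<in> C - S" for v
  proof -
    have sub: "f (v div q) \<subseteq> S"
      using div_C[of v] that unfolding S_def by blast
    then have "v \<in> row (v div q) - f (v div q)"
      using that unfolding row_def by blast
    then obtain x y where "x \<in> f (v div q)" "y \<in> f (v div q)" "x \<noteq> y" "r x v" "r y v"
      using f(3) by blast
    then show ?thesis
      using sub f(1)[of "v div q"] unfolding row_def by (intro bexI[of _ x] bexI[of _ y]) auto
  qed
  moreover have "\<exists>x\<in>S. \<exists>y\<in>S. x \<noteq> y \<and> r x v \<and> r y v \<and> x mod q = v mod q \<and> y mod q = v mod q"
    if "v \<in> C - S" for v
  proof -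
    have "v mod q < q"
      using False by simp
    then have sub: "g (v mod q) \<subseteq> S"
      unfolding S_def by blast
    then have "v \<in> col (v mod q) - g (v mod q)"
      using that unfolding col_def by blast
    then obtain x y where "x \<in> g (v mod q)" "y \<in> g (v mod q)" "x \<noteq> y" "r x v" "r y v"
      using g(3) by blast
    then show ?thesis
      using sub g(1)[of "v mod q"] unfolding col_def by (intro bexI[of _ x] bexI[of _ y]) auto
  qed
  ultimately show ?thesis
    unfolding C_def r_def by (intro exI[of _ S]) auto
qed auto

text \<open>If \<open>v\<close> were in another row than \<open>u\<close>, then both
  \<open>x\<close> and \<open>y\<close> would lie in the column of \<open>v\<close>. Being in one
  row as well, they would coincide. The columns are treated in the same way with \<open>x'\<close>
  and \<open>y'\<close>.\<close>

lemma rook_eqI: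
  fixes q u v :: nat
  assumes "x \<noteq> y" "x div q = u div q" "y div q = u div q"
    and "x' \<noteq> y'" "x' mod q = u mod q" "y' mod q = u mod q"
    and "\<And>z. z \<in> {x, y, x', y'} \<Longrightarrow> z div q = v div q \<or> z mod q = v mod q"
  shows "u = v"
proof -
  have eq: "a = b" if "a div q = b div q" "a mod q = b mod q" for a b
    using that by (metis div_mult_mod_eq)
  have "v div q = u div q"
    using assms(1-3) assms(7)[of x] assms(7)[of y] eq[of x y] by auto
  moreover have "v mod q = u mod q"
    using assms(4-6) assms(7)[of x'] assms(7)[of y'] eq[of x' y'] by auto
  ultimately show ?thesis
    using eq[of u v] by simp
qed

text \<open>The set consists of a locating set \<open>L\<close> of the clique, a doubly dominating
  set \<open>R\<close> of the rook side, and the corrections \<open>U\<close> and \<open>X\<close>.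
  Twice the sizes of \<open>R\<close> and \<open>X\<close> together give the term
  \<open>16 * q * n\<close>, and \<open>U\<close> gives the 2.\<close>

lemma dir_gamma_LD_clique_rook:
  assumes D: "orientation_of (clique_rook q) D" and n: "q < 2 ^ n"
  shows "2 * dir_gamma_LD D \<le> q\<^sup>2 + 2 + 16 * q * n"
proof -
  define m where "m = q\<^sup>2"
  define r where "r x y \<longleftrightarrow> (x, y) \<in> parcs D" for x y
  have adj: "clique_rook_adj q x y" if "r x y" for x y
    using D that unfolding r_def orientation_of_def by (auto simp: clique_rook_def)
  have verts: "pverts D = {..<2 * m}"
    using D unfolding orientation_of_def by (simp add: clique_rook_def m_def)
  obtain R where R: "R \<subseteq> {m..<2 * m}" "card R \<le> 4 * q * n" and
    rows: "\<And>v. v \<in> {m..<2 * m} - R \<Longrightarrow>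
      \<exists>x\<in>R. \<exists>y\<in>R. x \<noteq> y \<and> r x v \<and> r y v \<and> x div q = v div q \<and> y div q = v div q" and
    cols: "\<And>v. v \<in> {m..<2 * m} - R \<Longrightarrow>
      \<exists>x\<in>R. \<exists>y\<in>R. x \<noteq> y \<and> r x v \<and> r y v \<and> x mod q = v mod q \<and> y mod q = v mod q"
    using rook_double_dominating_set[OF D n] unfolding r_def m_def by blast
  have T: "tournament_on {..<m} r"
    unfolding r_def m_def
    by (intro orientation_tournament_on[OF pair_graph_clique_rook D])
      (auto simp: clique_rook_def clique_rook_adj_def)
  then obtain L where L: "L \<subseteq> {..<m}" "2 * card L \<le> m" "inj_on (\<lambda>v. {x \<in> L. r x v}) ({..<m} - L)"
    using tournament_locating_set[OF T] by auto
  \<comment> \<open>The locating set may leave one clique vertex undominated; it is added to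
    \<open>S\<close>.\<close>
  define U where "U = {v \<in> {..<m} - L. {x \<in> L. r x v} = {}}"
  \<comment> \<open>With the partners of \<open>R\<close> in \<open>S\<close>, no clique vertex
    outside \<open>S\<close> has an in-neighbour in \<open>R\<close>. Every rook vertex outside
    \<open>S\<close> has one, which separates the two sides.\<close>
  define X where "X = (\<lambda>x. x - m) ` R"
  define S where "S = L \<union> U \<union> X \<union> R"
  have fin: "finite L" "finite U" "finite R"
    using L(1) R(1) by (auto simp: U_def intro: finite_subset)
  have "card U \<le> Suc 0"
    using fin(2) L(3) unfolding U_def by (auto simp: card_le_Suc0_iff_eq dest: inj_onD)
  moreover have "card X \<le> 4 * q * n"
    using card_image_le[OF fin(3), of "\<lambda>x. x - m"] R(2) unfolding X_def by simp
  moreover have "card S \<le> card L + card U + card X + card R"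
    using card_Un_le[of "L \<union> U \<union> X" R] card_Un_le[of "L \<union> U" X] card_Un_le[of L U]
    unfolding S_def by linarith
  ultimately have card_S: "2 * card S \<le> m + 2 + 16 * q * n"
    using L(2) R(2) by simp
  have "X \<subseteq> {..<m}"
    using R(1) unfolding X_def by force
  then have SV: "S \<subseteq> {..<2 * m}"
    using L(1) R(1) unfolding S_def U_def by auto
  have dom_low: "\<exists>x\<in>L. r x v" if "v < m" "v \<notin> S" for v
    using that unfolding S_def U_def by auto
  have no_R: "x \<notin> R" if "v < m" "v \<notin> S" "r x v" for v x
    using adj[OF that(3)] that(1,2) R(1) unfolding S_def X_def clique_rook_adj_def m_def
    by (force simp: image_iff)
  have "locating_dominating {..<2 * m} (in_nbhd D) S"
    unfolding locating_dominating_def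
  proof (intro conjI ballI impI)
    fix u assume u: "u \<in> {..<2 * m} - S"
    show "in_nbhd D u \<inter> S \<noteq> {}"
    proof (cases "u < m")
      case True
      then show ?thesis
        using dom_low[of u] u unfolding in_nbhd_def r_def S_def by auto
    next
      case False
      then have "u \<in> {m..<2 * m} - R"
        using u unfolding S_def by auto
      then show ?thesis
        using rows[of u] unfolding in_nbhd_def r_def S_def by auto
    qed
  next
    fix u v assume u: "u \<in> {..<2 * m} - S" and v: "v \<in> {..<2 * m} - S" and "u \<noteq> v"
    show "in_nbhd D u \<inter> S \<noteq> in_nbhd D v \<inter> S"
    proof
      assume "in_nbhd D u \<inter> S = in_nbhd D v \<inter> S"
      then have eq: "r x u \<longleftrightarrow> r x v" if "x \<in> S" for x
        using that unfolding in_nbhd_def r_def by blast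
      have R_dom: "\<exists>x\<in>R. r x w" if "w \<in> {..<2 * m} - S" "\<not> w < m" for w
        using rows[of w] that unfolding S_def by auto
      have RS: "R \<subseteq> S"
        unfolding S_def by auto
      consider "u < m" "v < m" | "u < m" "\<not> v < m" | "\<not> u < m" "v < m" | "\<not> u < m" "\<not> v < m"
        by blast
      then show False
      proof cases
        case 1
        have "{x \<in> L. r x u} = {x \<in> L. r x v}"
          using eq unfolding S_def by blast
        then show False
          using L(3) 1 u v \<open>u \<noteq> v\<close> unfolding S_def by (auto dest: inj_onD)
      next
        case 2
        then show False
          using R_dom[of v] no_R[of u] u v eq RS by blast
      next
        case 3
        then show False
          using R_dom[of u] no_R[of v] u v eq RS by blast
      next
        case 4
        have uv: "u \<in> {m..<2 * m} - R" "m \<le> v"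
          using u 4 RS by auto
        obtain x y where xy: "x \<in> R" "y \<in> R" "x \<noteq> y" "r x u" "r y u" "x div q = u div q" "y div q = u div q"
          using rows[OF uv(1)] by blast
        obtain x' y' where xy': "x' \<in> R" "y' \<in> R" "x' \<noteq> y'" "r x' u" "r y' u"
            "x' mod q = u mod q" "y' mod q = u mod q"
          using cols[OF uv(1)] by blast
        \<comment> \<open>Equal traces make the four chosen in-neighbours of \<open>u\<close> also
          in-neighbours of \<open>v\<close>, hence cells in the row or column of
          \<open>v\<close>.\<close>
        have "z div q = v div q \<or> z mod q = v mod q" if "z \<in> {x, y, x', y'}" for z
        proof -
          have "z \<in> R" "r z u"
            using that xy xy' by auto
          then have "r z v" "m \<le> z" "z < 2 * m"
            using eq RS R(1) by auto
          then show ?thesis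
            using adj[of z v] uv(2) v unfolding clique_rook_adj_def m_def by auto
        qed
        then show False
          using rook_eqI[OF xy(3,6,7) xy'(3,6,7)] \<open>u \<noteq> v\<close> by blast
      qed
    qed
  qed (use SV in auto)
  then have "dir_gamma_LD D \<le> card S"
    by (intro dir_gamma_LD_le) (auto simp: verts)
  then show ?thesis
    using card_S unfolding m_def by linarith
qed

lemma upper_dir_gamma_LD_clique_rook_upper:
  assumes "q < 2 ^ n"
  shows "2 * upper_dir_gamma_LD (clique_rook q) \<le> q\<^sup>2 + 2 + 16 * q * n"
  using upper_dir_gamma_LD_attained[OF pair_graph_clique_rook[of q]] dir_gamma_LD_clique_rook[OF _ assms]
  by metis

theorem theorem40:
  shows "\<exists>G :: nat \<Rightarrow> nat pair_pre_digraph.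
           (\<forall>k. pair_graph (G k) \<and> twin_free (G k)) \<and>
           filterlim (\<lambda>k. card (pverts (G k))) at_top sequentially \<and>
           (\<lambda>k. real (upper_dir_gamma_LD (G k)) / real (gamma_LD (G k))) \<longlonglongrightarrow> 1 / 2"
proof -
  \<comment> \<open>For powers of two, the logarithmic parameter \<open>n\<close> can be taken as
    \<open>k + 2\<close>, and the bounds become explicit functions of \<open>k\<close>. The exponent
    \<open>Suc k\<close> ensures \<open>q k \<ge> 2\<close>, as twin-freeness requires.\<close>
  define q :: "nat \<Rightarrow> nat" where "q k = 2 ^ Suc k" for k
  define G where "G k = clique_rook (q k)" for k
  \<comment> \<open>With \<open>m = (q k)\<^sup>2\<close>, \<open>lo\<close> divides the lower bound
    \<open>(m - 1) / 2\<close> of the numerator by the upper bound \<open>m\<close> of the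
    denominator; \<open>hi\<close> divides the upper bound by \<open>m - 1\<close>.\<close>
  define lo :: "nat \<Rightarrow> real" where "lo k = ((2 ^ Suc k)\<^sup>2 - 1) / (2 * (2 ^ Suc k)\<^sup>2)" for k
  define hi :: "nat \<Rightarrow> real" where
    "hi k = ((2 ^ Suc k)\<^sup>2 + 2 + 16 * 2 ^ Suc k * (real k + 2)) / (2 * ((2 ^ Suc k)\<^sup>2 - 1))" for k
  have q2: "2 \<le> q k" for k
    by (simp add: q_def)
  have verts: "filterlim (\<lambda>k. card (pverts (G k))) at_top sequentially"
  proof (rule filterlim_at_top_mono)
    show "filterlim (\<lambda>k::nat. k) at_top sequentially"
      by (rule filterlim_ident)
    have "k \<le> 2 * (q k)\<^sup>2" for k
    proof -
      have "k < q k"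
        using less_exp[of "Suc k"] unfolding q_def by linarith
      also have "q k \<le> (q k)\<^sup>2"
        by (simp add: power2_eq_square)
      finally show ?thesis
        by simp
    qed
    then show "\<forall>\<^sub>F k in sequentially. k \<le> card (pverts (G k))"
      by (simp add: G_def clique_rook_def)
  qed
  have bounds: "lo k \<le> real (upper_dir_gamma_LD (G k)) / real (gamma_LD (G k)) \<and>
      real (upper_dir_gamma_LD (G k)) / real (gamma_LD (G k)) \<le> hi k" for k
  proof -
    define m where "m = (q k)\<^sup>2"
    define u where "u = upper_dir_gamma_LD (G k)"
    define g where "g = gamma_LD (G k)"
    have rm: "real m = (2 ^ Suc k)\<^sup>2"
      by (simp add: m_def q_def)
    have "4 \<le> m"
      using power_mono[OF q2[of k], of 2] by (simp add: m_def)
    have b: "m \<le> 2 * u + 1" "m \<le> g + 1" "g \<le> m"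
      using upper_dir_gamma_LD_clique_rook_lower gamma_LD_clique_rook_lower gamma_LD_clique_rook_upper
      unfolding m_def u_def g_def G_def by auto
    have "2 * u \<le> m + 2 + 16 * q k * (k + 2)"
      using upper_dir_gamma_LD_clique_rook_upper[of "q k" "k + 2"]
      unfolding m_def u_def G_def by (simp add: q_def)
    then have "2 * real u \<le> real (m + 2 + 16 * q k * (k + 2))"
      by (metis of_nat_le_iff of_nat_mult of_nat_numeral)
    then have up: "2 * real u \<le> real m + 2 + 16 * 2 ^ Suc k * (real k + 2)"
      by (simp add: q_def algebra_simps)
    have g: "0 < real g" "real m - 1 \<le> real g" "real g \<le> real m" "4 \<le> real m" "real m - 1 \<le> 2 * real u"
      using b \<open>4 \<le> m\<close> by linarith+
    have "lo k = (real m - 1) / 2 / real m"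
      unfolding lo_def rm[symmetric] by simp
    also have "\<dots> \<le> real u / real g"
      using g by (intro frac_le) auto
    finally have "lo k \<le> real u / real g" .
    moreover have "real u / real g \<le>
        ((real m + 2 + 16 * 2 ^ Suc k * (real k + 2)) / 2) / (real m - 1)"
      using g up by (intro frac_le) auto
    ultimately show ?thesis
      unfolding hi_def rm[symmetric] u_def g_def by (simp add: mult.commute)
  qed
  have "lo \<longlonglongrightarrow> 1 / 2" "hi \<longlonglongrightarrow> 1 / 2"
    unfolding lo_def hi_def by real_asymp+
  then have "(\<lambda>k. real (upper_dir_gamma_LD (G k)) / real (gamma_LD (G k))) \<longlonglongrightarrow> 1 / 2"
    by (rule tendsto_sandwich[rotated 2]) (use bounds in \<open>intro always_eventually; blast\<close>)+
  moreover have "pair_graph (G k) \<and> twin_free (G k)" for k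
    unfolding G_def using pair_graph_clique_rook twin_free_clique_rook[OF q2] by blast
  ultimately show ?thesis
    using verts by (intro exI[of _ G]) simp
qed

end
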